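(* For every $0 \le \theta < 1/2$ we have $f(\theta) \ge 1/2 - \theta$.
   Context: For $0 \le \theta < 1/2$, let $f(\theta)$ denote the least (infimum of) exponent $\phi \ge 0$ with the following property: there exist constants $c_1, c_2 > 0$ (which may depend on $\theta$) such that for every real $x \ge 1$ the interval $[x - c_1 x^{\phi}, x + c_1 x^{\phi}]$ contains an integer $n$ with $n = ab$, where $a$ and $b$ are integers lying in the interval $[x^{1/2} - c_2 x^{\theta}, x^{1/2} + c_2 x^{\theta}]$. *)

theory Defs
  imports Complex_Main
begin

definition admissible_exponent :: "real \<Rightarrow> real \<Rightarrow> bool" where
  "admissible_exponent \<theta> \<phi> \<longleftrightarrow>
     (\<exists>c1>0. \<exists>c2>0. \<forall>x::real. x \<ge> 1 \<longrightarrow>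
        (\<exists>n a b :: int. n = a * b \<and>
           real_of_int n \<in> {x - c1 * x powr \<phi> .. x + c1 * x powr \<phi>} \<and>
           real_of_int a \<in> {x powr (1/2) - c2 * x powr \<theta> .. x powr (1/2) + c2 * x powr \<theta>} \<and>
           real_of_int b \<in> {x powr (1/2) - c2 * x powr \<theta> .. x powr (1/2) + c2 * x powr \<theta>}))"

definition f :: "real \<Rightarrow> real" where
  "f \<theta> = Inf {\<phi>. \<phi> \<ge> 0 \<and> admissible_exponent \<theta> \<phi>}"

text \<open>On the reals \<open>Inf\<close> is only meaningful for sets that are nonempty and bounded below.
  The next two facts show that this is the case in the definition of \<open>f\<close>.\<close>

lemma admissible_exponent_half:
  assumes "0 \<le> \<theta>"
  shows "admissible_exponent \<theta> (1/2)"
proof -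
  have "\<exists>n a b :: int. n = a * b \<and>
           real_of_int n \<in> {x - 2 * x powr (1/2) .. x + 2 * x powr (1/2)} \<and>
           real_of_int a \<in> {x powr (1/2) - 1 * x powr \<theta> .. x powr (1/2) + 1 * x powr \<theta>} \<and>
           real_of_int b \<in> {x powr (1/2) - 1 * x powr \<theta> .. x powr (1/2) + 1 * x powr \<theta>}"
    if x: "x \<ge> 1" for x :: real
  proof -
    define s where "s = x powr (1/2)"
    define m where "m = \<lfloor>s\<rfloor>"
    have ss: "s * s = x" and s0: "s \<ge> 0"
      using x by (auto simp: s_def powr_add[symmetric])
    have pw: "x powr \<theta> \<ge> 1"
      using x assms by (simp add: ge_one_powr_ge_zero)
    have m: "real_of_int m \<le> s" "s < real_of_int m + 1"
      unfolding m_def by linarith+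
    have m0: "0 \<le> real_of_int m"
      using s0 by (simp add: m_def)
    have up: "real_of_int m * real_of_int m \<le> s * s"
      using m(1) m0 s0 by (intro mult_mono) auto
    have "s * s - real_of_int m * real_of_int m = (s - real_of_int m) * (s + real_of_int m)"
      by (simp add: algebra_simps)
    also have "\<dots> \<le> 1 * (s + s)"
      using m m0 s0 by (intro mult_mono) auto
    finally have lo: "s * s - real_of_int m * real_of_int m \<le> 2 * s"
      by simp
    show ?thesis
      by (rule exI[of _ "m * m"], rule exI[of _ m], rule exI[of _ m])
         (use ss s0 pw m up lo in \<open>auto simp: s_def[symmetric]\<close>)
  qed
  then show ?thesis
    unfolding admissible_exponent_def
    by (intro exI[of _ 2] conjI exI[of _ 1]) auto
qed

lemma f_Inf_proper:
  assumes "0 \<le> \<theta>"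
  shows "{\<phi>. \<phi> \<ge> 0 \<and> admissible_exponent \<theta> \<phi>} \<noteq> {}"
    and "bdd_below {\<phi>. \<phi> \<ge> 0 \<and> admissible_exponent \<theta> \<phi>}"
  using admissible_exponent_half[OF assms] by (auto intro!: exI[of _ "1/2"] bdd_belowI[of _ 0])

end

theory Submission
  imports Defs "HOL-Real_Asymp.Real_Asymp"
begin

text \<open>The proof counts products. Among the reals in \<open>[N\<^sup>2, N\<^sup>2 + N]\<close> pick about \<open>N\<^bsup>1-2\<phi>\<^esup>\<close>
  points so far apart that their intervals of radius \<open>c\<^sub>1 x\<^bsup>\<phi>\<^esup>\<close> are disjoint; admissibility attaches
  to them pairwise distinct pairs \<open>(a, b)\<close>. Now \<open>a\<close> takes only \<open>O(N\<^bsup>2\<theta>\<^esup>)\<close> values, and for fixed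
  \<open>a \<ge> N/2\<close> the products \<open>a b\<close> lie in a window of length \<open>O(N)\<close>, which leaves \<open>O(1)\<close> values of \<open>b\<close>.
  Hence \<open>N\<^bsup>1-2\<phi>\<^esup> = O(N\<^bsup>2\<theta>\<^esup>)\<close>.\<close>

text \<open>Dividing the product window by \<open>a\<close> \<ge> \<open>l\<close> > 0 confines
  \<open>b\<close> to an interval of length at most \<open>r\<close>. Its left end
  \<open>L / a\<close> varies with \<open>a\<close>, so subtracting
  \<open>\<lceil>L / a\<rceil>\<close> from \<open>b\<close> moves all pairs injectively into one
  fixed box.\<close>

lemma card_pairs_product_window_le:
  fixes S :: "(int \<times> int) set" and l u L :: real and r :: nat
  assumes l: "0 < l" "l \<le> u"
    and S: "\<And>a b. (a, b) \<in> S \<Longrightarrow> l \<le> a \<and> a \<le> u \<and> L \<le> a * b \<and> a * b \<le> L + r * l"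
  shows "card S \<le> (u - l + 1) * (r + 1)"
proof -
  define g :: "int \<times> int \<Rightarrow> int \<times> int" where "g = (\<lambda>(a::int, b::int). (a, b - \<lceil>L / a\<rceil>))"
  have inj: "inj_on g S"
    by (auto simp: inj_on_def g_def)
  have sub: "g ` S \<subseteq> {\<lceil>l\<rceil>..\<lfloor>u\<rfloor>} \<times> {0..int r}"
  proof clarify
    fix a b a' b' assume ab: "(a, b) \<in> S" and g: "(a', b') = g (a, b)"
    note s = S[OF ab]
    have a: "0 < real_of_int a" using s l by linarith
    have lo: "L / a \<le> b"
      using s a by (simp add: divide_le_eq mult.commute)
    have "r * l \<le> r * real_of_int a"
      using s by (intro mult_left_mono) auto
    with s have "real_of_int a * b \<le> L + r * real_of_int a" by linarith
    then have "b \<le> L / a + r"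
      using a by (simp add: field_simps)
    then have "real_of_int b \<le> \<lceil>L / a\<rceil> + real r" by linarith
    then have "b \<le> \<lceil>L / a\<rceil> + int r" by linarith
    moreover have "\<lceil>L / a\<rceil> \<le> b" using lo by (simp add: ceiling_le_iff)
    moreover have "\<lceil>l\<rceil> \<le> a" "a \<le> \<lfloor>u\<rfloor>"
      using s by (auto simp: ceiling_le_iff le_floor_iff)
    ultimately show "a' \<in> {\<lceil>l\<rceil>..\<lfloor>u\<rfloor>} \<and> b' \<in> {0..int r}"
      using g by (auto simp: g_def)
  qed
  have "card S = card (g ` S)"
    using inj by (simp add: card_image)
  also have "\<dots> \<le> card ({\<lceil>l\<rceil>..\<lfloor>u\<rfloor>} \<times> {0..int r})"
    using sub by (intro card_mono) auto
  also have "\<dots> = nat (\<lfloor>u\<rfloor> - \<lceil>l\<rceil> + 1) * (r + 1)"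
    by (simp add: card_cartesian_product nat_add_distrib)
  finally have "real (card S) \<le> real (nat (\<lfloor>u\<rfloor> - \<lceil>l\<rceil> + 1) * (r + 1))"
    by (rule of_nat_mono)
  also have "\<dots> = real (nat (\<lfloor>u\<rfloor> - \<lceil>l\<rceil> + 1)) * (r + 1)"
    by (simp add: algebra_simps)
  \<comment> \<open>From \<open>l\<close> \<le> \<open>u\<close> follows
    \<open>\<lceil>l\<rceil> - 1\<close> \<le> \<open>\<lfloor>u\<rfloor>\<close>, so
    \<open>nat\<close> does not truncate.\<close>
  also have "\<dots> \<le> (u - l + 1) * (r + 1)"
    by (intro mult_right_mono) (use l in linarith)+
  finally show ?thesis .
qed

lemma eventually_powr_less:
  fixes C e :: real
  assumes "e < 1"
  shows "\<forall>\<^sub>F N in at_top. C * (2 * real N) powr e < real N"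
  using assms by real_asymp

lemma admissible_exponent_ge:
  assumes \<theta>: "0 \<le> \<theta>" "\<theta> < 1/2" and \<phi>: "0 \<le> \<phi>" and adm: "admissible_exponent \<theta> \<phi>"
  shows "1/2 - \<theta> \<le> \<phi>"
proof (rule ccontr)
  assume "\<not> 1/2 - \<theta> \<le> \<phi>"
  then have lt: "2 * \<theta> + 2 * \<phi> < 1" by simp
  obtain c1 c2 where c: "c1 > 0" "c2 > 0" and all: "\<forall>x::real. x \<ge> 1 \<longrightarrow>
        (\<exists>n a b :: int. n = a * b \<and>
           real_of_int n \<in> {x - c1 * x powr \<phi> .. x + c1 * x powr \<phi>} \<and>
           real_of_int a \<in> {x powr (1/2) - c2 * x powr \<theta> .. x powr (1/2) + c2 * x powr \<theta>} \<and>
           real_of_int b \<in> {x powr (1/2) - c2 * x powr \<theta> .. x powr (1/2) + c2 * x powr \<theta>})"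
    using adm unfolding admissible_exponent_def by auto
  have *: "\<exists>(a :: int) (b :: int). \<bar>real_of_int a * b - x\<bar> \<le> c1 * x powr \<phi> \<and> \<bar>a - x powr (1/2)\<bar> \<le> c2 * x powr \<theta>"
    if x1: "x \<ge> 1" for x :: real
  proof -
    obtain n a b :: int where "n = a * b" "n \<in> {x - c1 * x powr \<phi> .. x + c1 * x powr \<phi>}"
        "a \<in> {x powr (1/2) - c2 * x powr \<theta> .. x powr (1/2) + c2 * x powr \<theta>}"
      using all x1 by blast
    then have "\<bar>real_of_int a * b - x\<bar> \<le> c1 * x powr \<phi> \<and> \<bar>a - x powr (1/2)\<bar> \<le> c2 * x powr \<theta>"
      by (auto simp: abs_le_iff)
    then show ?thesis by blast
  qed
  \<comment> \<open>The base \<open>2 * N\<close> appears because all sample points are at most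
    \<open>(2 * N)^2\<close>. The middle two bounds keep the error in the product below
    \<open>N\<close> and the deviation of \<open>a\<close> below \<open>N / 2\<close>. The last is
    what the count contradicts: \<open>4 * c1\<close> comes from the spacing, 7 bounds the choices
    of \<open>b\<close> for one \<open>a\<close>, and \<open>2 * c2 + 2\<close> comes from the
    number of values of \<open>a\<close>.\<close>
  have "\<forall>\<^sub>F N in at_top. N \<ge> 1 \<and> c1 * (2 * real N) powr (2 * \<phi>) < N \<and>
      2 * c2 * (2 * real N) powr (2 * \<theta>) < N \<and>
      4 * c1 * 7 * (2 * c2 + 2) * (2 * real N) powr (2 * \<theta> + 2 * \<phi>) < N"
    by (intro eventually_conj eventually_ge_at_top eventually_powr_less) (use lt \<theta> \<phi> in auto)
  then obtain N :: nat where N: "N \<ge> 1" "c1 * (2 * real N) powr (2 * \<phi>) < N"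
      "2 * c2 * (2 * real N) powr (2 * \<theta>) < N"
      "4 * c1 * 7 * (2 * c2 + 2) * (2 * real N) powr (2 * \<theta> + 2 * \<phi>) < N"
    by (auto simp: eventually_at_top_linorder)
  define P where "P = (2 * real N) powr (2 * \<phi>)"
  define T where "T = (2 * real N) powr (2 * \<theta>)"
  \<comment> \<open>Points sharing a pair differ by at most \<open>2 * c1 * P\<close>, which is half
    this spacing.\<close>
  define h where "h = 4 * c1 * P"
  define x where "x k = real N ^ 2 + real k * h" for k :: nat
  \<comment> \<open>Stopping at \<open>N^2 + N\<close> \<le> \<open>(N + 1)^2\<close> keeps every
    square root in \<open>[N, N + 1]\<close>, so one window serves all the
    \<open>a k\<close>.\<close>
  define K where "K = {k::nat. real k * h \<le> N}"
  have P: "P \<ge> 1" and T: "T \<ge> 1"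
    using N(1) \<theta> \<phi> by (auto simp: P_def T_def intro!: ge_one_powr_ge_zero)
  have h: "h > 0" using c P by (simp add: h_def)
  have sq: "real N ^ 2 \<ge> real N" using N(1) by (simp add: power2_eq_square)
  have four: "(4 * real N ^ 2) powr e = (2 * real N) powr (2 * e)" for e
  proof -
    have "4 * real N ^ 2 = (2 * real N) powr 2"
      using N(1) by (simp add: power_mult_distrib)
    then show ?thesis by (simp only: powr_powr)
  qed
  have x: "x k \<ge> 1" "N \<le> x k powr (1/2)" "x k powr (1/2) \<le> N + 1"
    "x k powr \<phi> \<le> P" "x k powr \<theta> \<le> T" if "k \<in> K" for k
  proof -
    have k: "0 \<le> real k * h" "real k * h \<le> N" using that h by (auto simp: K_def)
    show 1: "x k \<ge> 1" using N(1) sq k unfolding x_def by linarith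
    have le: "x k \<le> 4 * real N ^ 2" using sq k unfolding x_def by linarith
    show "x k powr \<phi> \<le> P" "x k powr \<theta> \<le> T"
      using powr_mono2[OF _ _ le] 1 \<theta> \<phi> by (auto simp: four P_def T_def)
    show "N \<le> x k powr (1/2)" "x k powr (1/2) \<le> N + 1"
      using 1 k by (auto simp: powr_half_sqrt x_def power2_eq_square algebra_simps
          intro!: real_le_rsqrt real_le_lsqrt)
  qed
  have "\<exists>(a :: int) (b :: int). \<bar>real_of_int a * b - x k\<bar> \<le> c1 * P \<and> N - c2 * T \<le> a \<and> a \<le> N + 1 + c2 * T"
    if k: "k \<in> K" for k
  proof -
    obtain a b :: int where ab: "\<bar>real_of_int a * b - x k\<bar> \<le> c1 * x k powr \<phi>"
        "\<bar>a - x k powr (1/2)\<bar> \<le> c2 * x k powr \<theta>"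
      using *[OF x(1)[OF k]] by blast
    have "c1 * x k powr \<phi> \<le> c1 * P" "c2 * x k powr \<theta> \<le> c2 * T"
      using x[OF k] c by auto
    with ab x(2,3)[OF k] have "\<bar>real_of_int a * b - x k\<bar> \<le> c1 * P \<and> N - c2 * T \<le> a \<and> a \<le> N + 1 + c2 * T"
      by (auto simp: abs_le_iff)
    then show ?thesis by blast
  qed
  then obtain a b :: "nat \<Rightarrow> int" where
    ab: "\<And>k. k \<in> K \<Longrightarrow> \<bar>real_of_int (a k) * b k - x k\<bar> \<le> c1 * P"
      "\<And>k. k \<in> K \<Longrightarrow> N - c2 * T \<le> a k" "\<And>k. k \<in> K \<Longrightarrow> a k \<le> N + 1 + c2 * T"
    by metis
  define p where "p k = (a k, b k)" for k
  have inj: "inj_on p K"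
  proof (rule inj_onI, rule ccontr)
    fix j k assume jk: "j \<in> K" "k \<in> K" "p j = p k" "j \<noteq> k"
    have "\<bar>x j - x k\<bar> \<le> 2 * (c1 * P)"
      using ab(1)[OF jk(1)] ab(1)[OF jk(2)] jk(3) by (simp add: p_def)
    moreover have "\<bar>x j - x k\<bar> = \<bar>real j - real k\<bar> * h"
      using h by (simp add: x_def abs_mult flip: left_diff_distrib)
    moreover have "1 * h \<le> \<bar>real j - real k\<bar> * h"
      using jk(4) h by (intro mult_right_mono) linarith+
    ultimately show False
      using h unfolding h_def by linarith
  qed
  have c2T: "c2 * T \<le> N / 2" and c1P: "c1 * P \<le> N"
    using N by (simp_all add: T_def P_def)
  \<comment> \<open>The products lie in \<open>[N^2 - N, N^2 + 2 * N]\<close>. This has length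
    \<open>3 * N = 6 * (N / 2)\<close>, and \<open>N / 2\<close> \<le> \<open>N - c2 * T\<close>,
    whence \<open>r = 6\<close>.\<close>
  have "real (card (p ` K)) \<le> ((N + 1 + c2 * T) - (N - c2 * T) + 1) * (6 + 1)"
  proof -
    have "N - c2 * T \<le> a' \<and> a' \<le> N + 1 + c2 * T \<and> real N ^ 2 - N \<le> a' * b' \<and>
        a' * b' \<le> (real N ^ 2 - N) + real 6 * (N - c2 * T)" if "(a', b') \<in> p ` K" for a' b'
    proof -
      obtain k where k: "k \<in> K" "a' = a k" "b' = b k" using \<open>(a', b') \<in> p ` K\<close> by (auto simp: p_def)
      have "0 \<le> real k * h" "real k * h \<le> N" using k(1) h by (auto simp: K_def)
      then show ?thesis
        using ab[OF k(1)] c1P c2T unfolding x_def k(2,3) by (auto simp: abs_le_iff)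
    qed
    moreover have "0 < N - c2 * T" using c2T N(1) by linarith
    moreover have "N - c2 * T \<le> N + 1 + c2 * T" using c T by simp
    ultimately show ?thesis
      using card_pairs_product_window_le[of "N - c2 * T" "N + 1 + c2 * T" "p ` K" "real N ^ 2 - N" 6]
      by simp
  qed
  also have "\<dots> \<le> 7 * ((2 * c2 + 2) * T)"
    using T by (simp add: algebra_simps)
  finally have up: "real (card K) \<le> 7 * ((2 * c2 + 2) * T)"
    using inj by (simp add: card_image)
  have K: "K = {..nat \<lfloor>N / h\<rfloor>}"
    using h by (auto simp: K_def le_nat_iff le_floor_iff field_simps)
  \<comment> \<open>The index 0 counts as well, so the cardinality is
    \<open>\<lfloor>N / h\<rfloor> + 1\<close>, which exceeds \<open>N / h\<close>.\<close>
  have "N / h \<le> real (card K)"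
    unfolding K by (simp, linarith)
  with up h have "N \<le> 7 * ((2 * c2 + 2) * T) * h"
    by (simp add: divide_le_eq) (meson mult_right_mono order_trans less_imp_le)
  also have "\<dots> = 4 * c1 * 7 * (2 * c2 + 2) * (2 * real N) powr (2 * \<theta> + 2 * \<phi>)"
    by (simp add: h_def P_def T_def powr_add)
  finally show False using N(4) by simp
qed

theorem theorem2:
  fixes \<theta> :: real
  assumes "0 \<le> \<theta>" and "\<theta> < 1/2"
  shows "f \<theta> \<ge> 1/2 - \<theta>"
  unfolding f_def
  by (rule cInf_greatest[OF f_Inf_proper(1)]) (use assms admissible_exponent_ge in auto)

end
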